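(* Let $G$ be a group, let $R$ and $T$ be $G$-graded rings, let $f:R\rightarrow T$ be a graded ring epimorphism, and let $J$ be a graded almost prime right ideal of $T$ such that $\mathrm{Ker}(f)\subseteq (f^{-1}(J))^{2}$. Then $f^{-1}(J)$ is a graded almost prime right ideal of $R$.
   Context: Rings are associative, not assumed commutative, and not assumed to have a unity. A ring $R$ is $G$-graded if $R=\bigoplus_{g\in G}R_g$ with $R_g$ additive subgroups and $R_gR_h\subseteq R_{gh}$ for all $g,h\in G$; $x_g$ denotes the component of $x\in R$ in $R_g$. A right ideal $P$ is graded if $P=\bigoplus_{g\in G}(P\cap R_g)$, i.e. $x\in P$ implies $x_g\in P$ for all $g\in G$. The product $XY$ of right ideals is the set of finite sums of products $xy$ with $x\in X$, $y\in Y$, and $P^2=PP$. A ring homomorphism $f:R\to T$ of $G$-graded rings is graded if $f(R_g)\subseteq T_g$ for all $g\in G$; "epimorphism" means surjective homomorphism. A proper graded right ideal $P$ of a graded ring $R$ is graded almost prime if, for all graded right ideals $X,Y$ of $R$, $XY\subseteq P$ and $XY\nsubseteq P^2$ imply $X\subseteq P$ or $Y\subseteq P$. *)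

theory Defs
  imports Main
begin

text \<open>
  The class \<^class>\<open>ring\<close> is used for associative rings, possibly noncommutative and
  without unity; a ring is a type of this class.  The grading group is a type of class
  \<^class>\<open>group_add\<close>: an arbitrary, not necessarily abelian, group, with the group
  operation written additively, so that the product \<open>gh\<close> of the grading group reads \<open>g + h\<close>
  and its identity reads \<open>0\<close>.
\<close>

definition additive_subgroup :: "'a::ab_group_add set \<Rightarrow> bool" where
  "additive_subgroup A \<longleftrightarrow>
     0 \<in> A \<and> (\<forall>x\<in>A. \<forall>y\<in>A. x + y \<in> A) \<and> (\<forall>x\<in>A. - x \<in> A)"

definition is_decomposition ::
    "('g \<Rightarrow> 'a::ab_group_add set) \<Rightarrow> 'a \<Rightarrow> ('g \<Rightarrow> 'a) \<Rightarrow> bool" where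
  "is_decomposition R x c \<longleftrightarrow>
     (\<forall>g. c g \<in> R g) \<and> finite {g. c g \<noteq> 0} \<and> x = (\<Sum>g\<in>{g. c g \<noteq> 0}. c g)"

text \<open>The unique existence of decompositions says that the whole ring is the (internal)
  direct sum of the subgroups \<open>R g\<close>.\<close>

definition graded_ring :: "('g::group_add \<Rightarrow> 'a::ring set) \<Rightarrow> bool" where
  "graded_ring R \<longleftrightarrow>
     (\<forall>g. additive_subgroup (R g)) \<and>
     (\<forall>x. \<exists>!c. is_decomposition R x c) \<and>
     (\<forall>g h. \<forall>x\<in>R g. \<forall>y\<in>R h. x * y \<in> R (g + h))"

definition component :: "('g \<Rightarrow> 'a::ab_group_add set) \<Rightarrow> 'a \<Rightarrow> 'g \<Rightarrow> 'a" where
  "component R x = (THE c. is_decomposition R x c)"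

definition right_ideal :: "'a::ring set \<Rightarrow> bool" where
  "right_ideal P \<longleftrightarrow> additive_subgroup P \<and> (\<forall>x\<in>P. \<forall>r. x * r \<in> P)"

definition graded_right_ideal :: "('g::group_add \<Rightarrow> 'a::ring set) \<Rightarrow> 'a set \<Rightarrow> bool" where
  "graded_right_ideal R P \<longleftrightarrow> right_ideal P \<and> (\<forall>x\<in>P. \<forall>g. component R x g \<in> P)"

definition ideal_prod :: "'a::ring set \<Rightarrow> 'a set \<Rightarrow> 'a set" where
  "ideal_prod X Y =
     {(\<Sum>i<n. x i * y i) | (n::nat) x y. \<forall>i<n. x i \<in> X \<and> y i \<in> Y}"

definition graded_almost_prime :: "('g::group_add \<Rightarrow> 'a::ring set) \<Rightarrow> 'a set \<Rightarrow> bool" where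
  "graded_almost_prime R P \<longleftrightarrow>
     graded_right_ideal R P \<and> P \<noteq> UNIV \<and>
     (\<forall>X Y. graded_right_ideal R X \<longrightarrow> graded_right_ideal R Y \<longrightarrow>
        ideal_prod X Y \<subseteq> P \<longrightarrow> \<not> ideal_prod X Y \<subseteq> ideal_prod P P \<longrightarrow>
        X \<subseteq> P \<or> Y \<subseteq> P)"

definition ring_homomorphism :: "('a::ring \<Rightarrow> 'b::ring) \<Rightarrow> bool" where
  "ring_homomorphism f \<longleftrightarrow>
     (\<forall>x y. f (x + y) = f x + f y) \<and> (\<forall>x y. f (x * y) = f x * f y)"

definition graded_ring_homomorphism ::
    "('g::group_add \<Rightarrow> 'a::ring set) \<Rightarrow> ('g \<Rightarrow> 'b::ring set) \<Rightarrow> ('a \<Rightarrow> 'b) \<Rightarrow> bool" where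
  "graded_ring_homomorphism R T f \<longleftrightarrow> ring_homomorphism f \<and> (\<forall>g. f ` R g \<subseteq> T g)"

definition ring_kernel :: "('a::ring \<Rightarrow> 'b::ring) \<Rightarrow> 'a set" where
  "ring_kernel f = f -` {0}"

end

theory Submission
  imports Defs
begin

text \<open>
  Write \<open>P\<close> for \<open>f -` J\<close>.  A surjective graded homomorphism sends graded right ideals to graded
  right ideals (\<open>graded_right_ideal_image\<close>) and products to products (\<open>image_ideal_prod\<close>), so a
  pair \<open>X, Y\<close> of graded right ideals of the source can be tested on \<open>f ` X, f ` Y\<close>: the
  inclusions \<open>X Y \<subseteq> P\<close>, \<open>X \<subseteq> P\<close> and \<open>Y \<subseteq> P\<close> hold exactly when their images lie in \<open>J\<close>.
  The condition \<open>\<not> X Y \<subseteq> P\<^sup>2\<close> is the only one that is not of this form.  Since \<open>f ` P = J\<close>, the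
  square \<open>P\<^sup>2\<close> maps onto \<open>J\<^sup>2\<close>, so if the image of \<open>X Y\<close> were inside \<open>J\<^sup>2\<close>, then \<open>X Y\<close> would be
  inside \<open>P\<^sup>2 + Ker f\<close>; the hypothesis \<open>Ker f \<subseteq> P\<^sup>2\<close> makes this sum equal to \<open>P\<^sup>2\<close>.
\<close>

lemma ring_homomorphism_simps:
  assumes "ring_homomorphism f"
  shows "f (x + y) = f x + f y" "f (x * y) = f x * f y" "f 0 = 0" "f (- x) = - f x"
    "f (x - y) = f x - f y"
proof -
  show add: "f (x + y) = f x + f y" for x y
    using assms by (simp add: ring_homomorphism_def)
  show "f (x * y) = f x * f y"
    using assms by (simp add: ring_homomorphism_def)
  show zero: "f 0 = 0"
    using add[of 0 0] by simp
  show neg: "f (- x) = - f x" for x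
    using add[of "- x" x] zero by (simp add: eq_neg_iff_add_eq_0)
  show "f (x - y) = f x - f y"
    using add[of x "- y"] neg by simp
qed

lemma ring_homomorphism_sum:
  assumes "ring_homomorphism f"
  shows "f (sum h A) = (\<Sum>i\<in>A. f (h i))"
  by (induction A rule: infinite_finite_induct) (simp_all add: ring_homomorphism_simps[OF assms])

lemma ideal_prod_add:
  assumes "a \<in> ideal_prod X Y" "b \<in> ideal_prod X Y"
  shows "a + b \<in> ideal_prod X Y"
proof -
  obtain n and x y :: "nat \<Rightarrow> 'a" where a: "a = (\<Sum>i<n. x i * y i)" "\<forall>i<n. x i \<in> X \<and> y i \<in> Y"
    using assms(1) unfolding ideal_prod_def by blast
  obtain m and x' y' :: "nat \<Rightarrow> 'a" where b: "b = (\<Sum>i<m. x' i * y' i)" "\<forall>i<m. x' i \<in> X \<and> y' i \<in> Y"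
    using assms(2) unfolding ideal_prod_def by blast
  define u where "u i = (if i < n then x i else x' (i - n))" for i
  define v where "v i = (if i < n then y i else y' (i - n))" for i
  have split: "(\<Sum>i<n+m. h i) = (\<Sum>i<n. h i) + (\<Sum>i<m. h (n + i))" for h :: "nat \<Rightarrow> 'a"
    by (induction m) (simp_all add: add.assoc)
  have "(\<Sum>i<n+m. u i * v i) = a + b"
    unfolding split a b by (simp add: u_def v_def)
  moreover have "\<forall>i<n+m. u i \<in> X \<and> v i \<in> Y"
    using a(2) b(2) by (auto simp: u_def v_def)
  ultimately show ?thesis
    unfolding ideal_prod_def by (intro CollectI exI[of _ "n + m"] exI[of _ u] exI[of _ v]) simp
qed

lemma image_ideal_prod:
  assumes hom: "ring_homomorphism f"
  shows "f ` ideal_prod X Y = ideal_prod (f ` X) (f ` Y)"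
proof
  show "f ` ideal_prod X Y \<subseteq> ideal_prod (f ` X) (f ` Y)"
  proof
    fix b assume "b \<in> f ` ideal_prod X Y"
    then obtain n and x y :: "nat \<Rightarrow> 'a"
      where b: "b = f (\<Sum>i<n. x i * y i)" and xy: "\<forall>i<n. x i \<in> X \<and> y i \<in> Y"
      unfolding ideal_prod_def by blast
    have "b = (\<Sum>i<n. f (x i) * f (y i))"
      unfolding b by (simp add: ring_homomorphism_sum[OF hom] ring_homomorphism_simps[OF hom])
    moreover have "\<forall>i<n. f (x i) \<in> f ` X \<and> f (y i) \<in> f ` Y"
      using xy by blast
    ultimately show "b \<in> ideal_prod (f ` X) (f ` Y)"
      unfolding ideal_prod_def
      by (intro CollectI exI[of _ n] exI[of _ "\<lambda>i. f (x i)"] exI[of _ "\<lambda>i. f (y i)"]) simp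
  qed
next
  show "ideal_prod (f ` X) (f ` Y) \<subseteq> f ` ideal_prod X Y"
  proof
    fix b assume "b \<in> ideal_prod (f ` X) (f ` Y)"
    then obtain n and x y :: "nat \<Rightarrow> 'b"
      where b: "b = (\<Sum>i<n. x i * y i)" and xy: "\<forall>i<n. x i \<in> f ` X \<and> y i \<in> f ` Y"
      unfolding ideal_prod_def by blast
    define u where "u i = inv_into X f (x i)" for i
    define v where "v i = inv_into Y f (y i)" for i
    have uv: "\<forall>i<n. u i \<in> X \<and> v i \<in> Y" "\<forall>i<n. f (u i) = x i \<and> f (v i) = y i"
      using xy by (auto simp: u_def v_def inv_into_into f_inv_into_f)
    have "b = f (\<Sum>i<n. u i * v i)"
      unfolding b using uv(2)
      by (simp add: ring_homomorphism_sum[OF hom] ring_homomorphism_simps[OF hom])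
    moreover have "(\<Sum>i<n. u i * v i) \<in> ideal_prod X Y"
      unfolding ideal_prod_def using uv(1) by blast
    ultimately show "b \<in> f ` ideal_prod X Y"
      by blast
  qed
qed

lemma right_ideal_image:
  assumes hom: "ring_homomorphism f" and "surj f" and "right_ideal X"
  shows "right_ideal (f ` X)"
proof -
  have X: "0 \<in> X" "x + y \<in> X" "- x \<in> X" "x * r \<in> X" if "x \<in> X" "y \<in> X" for x y r
    using assms(3) that by (auto simp: right_ideal_def additive_subgroup_def)
  have X0: "0 \<in> X"
    using assms(3) by (simp add: right_ideal_def additive_subgroup_def)
  note simps = ring_homomorphism_simps[OF hom, symmetric]
  have "0 \<in> f ` X"
    using X0 simps(3) by (metis imageI)
  moreover have "f x + f y \<in> f ` X" "- f x \<in> f ` X" if "x \<in> X" "y \<in> X" for x y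
    using X[OF that] simps by auto
  \<comment> \<open>Surjectivity enters here: a multiplier in the target ring has to come from the source.\<close>
  moreover have "f x * t \<in> f ` X" if "x \<in> X" for x t
  proof -
    obtain r where "t = f r"
      using \<open>surj f\<close> by blast
    then show ?thesis
      using X(4)[OF that that] simps(2) by auto
  qed
  ultimately show ?thesis
    by (auto simp: right_ideal_def additive_subgroup_def)
qed

lemma right_ideal_vimage:
  assumes hom: "ring_homomorphism f" and "right_ideal J"
  shows "right_ideal (f -` J)"
  using assms(2) unfolding right_ideal_def additive_subgroup_def
  by (simp add: ring_homomorphism_simps[OF hom])

lemma component_eqI:
  assumes "graded_ring R" "is_decomposition R x c"
  shows "component R x = c"
proof -
  have "\<exists>!c. is_decomposition R x c"
    using assms(1) by (simp add: graded_ring_def)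
  then show ?thesis
    unfolding component_def using assms(2) by (simp add: the1_equality)
qed

lemma is_decomposition_component:
  assumes "graded_ring R"
  shows "is_decomposition R x (component R x)"
proof -
  have "\<exists>!c. is_decomposition R x c"
    using assms by (simp add: graded_ring_def)
  then show ?thesis
    unfolding component_def by (rule theI')
qed

text \<open>
  Applying \<open>f\<close> to each homogeneous component of \<open>x\<close> gives a decomposition of \<open>f x\<close>, with a
  possibly smaller support, and decompositions in the target are unique.
\<close>

lemma component_hom:
  assumes "graded_ring R" "graded_ring T" and hom: "graded_ring_homomorphism R T f"
  shows "component T (f x) g = f (component R x g)"
proof -
  let ?c = "component R x"
  have f: "ring_homomorphism f" and fg: "\<And>g. f ` R g \<subseteq> T g"
    using hom by (simp_all add: graded_ring_homomorphism_def)
  have c: "\<And>g. ?c g \<in> R g" "finite {g. ?c g \<noteq> 0}" "x = (\<Sum>g\<in>{g. ?c g \<noteq> 0}. ?c g)"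
    using is_decomposition_component[OF assms(1), of x] by (auto simp: is_decomposition_def)
  have sub: "{g. f (?c g) \<noteq> 0} \<subseteq> {g. ?c g \<noteq> 0}"
    by (auto simp: ring_homomorphism_simps(3)[OF f])
  have "f x = (\<Sum>g\<in>{g. ?c g \<noteq> 0}. f (?c g))"
    using c(3) ring_homomorphism_sum[OF f] by metis
  also have "\<dots> = (\<Sum>g\<in>{g. f (?c g) \<noteq> 0}. f (?c g))"
    using c(2) sub by (intro sum.mono_neutral_right) auto
  finally have "is_decomposition T (f x) (\<lambda>g. f (?c g))"
    unfolding is_decomposition_def using c(1) fg finite_subset[OF sub c(2)] by blast
  from component_eqI[OF assms(2) this] show ?thesis
    by simp
qed

lemma graded_right_ideal_image:
  assumes "graded_ring R" "graded_ring T" "graded_ring_homomorphism R T f" "surj f"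
    and "graded_right_ideal R X"
  shows "graded_right_ideal T (f ` X)"
  using assms right_ideal_image[of f X]
  by (auto simp: graded_right_ideal_def component_hom[OF assms(1-3)] graded_ring_homomorphism_def)

lemma graded_right_ideal_vimage:
  assumes "graded_ring R" "graded_ring T" "graded_ring_homomorphism R T f"
    and "graded_right_ideal T J"
  shows "graded_right_ideal R (f -` J)"
  using assms right_ideal_vimage[of f J]
  by (auto simp: graded_right_ideal_def component_hom[OF assms(1-3), symmetric]
      graded_ring_homomorphism_def)

text \<open>
  Two elements with the same image differ by an element of the kernel, and a product
  set that contains the kernel absorbs this difference because it is closed under addition.
\<close>

lemma ideal_prod_saturated:
  assumes hom: "ring_homomorphism f" and "ring_kernel f \<subseteq> ideal_prod X Y"
    and "f a \<in> f ` ideal_prod X Y"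
  shows "a \<in> ideal_prod X Y"
proof -
  obtain p where p: "p \<in> ideal_prod X Y" "f a = f p"
    using assms(3) by blast
  have "a - p \<in> ideal_prod X Y"
    using p(2) assms(2) by (auto simp: ring_kernel_def ring_homomorphism_simps[OF hom])
  then show ?thesis
    using ideal_prod_add[OF p(1)] by fastforce
qed

theorem corollary2p15:
  fixes R :: "'g::group_add \<Rightarrow> 'a::ring set"
    and T :: "'g \<Rightarrow> 'b::ring set"
    and f :: "'a \<Rightarrow> 'b"
    and J :: "'b set"
  assumes "graded_ring R"
    and "graded_ring T"
    and "graded_ring_homomorphism R T f"
    and "surj f"
    and "graded_almost_prime T J"
    and "ring_kernel f \<subseteq> ideal_prod (f -` J) (f -` J)"
  shows "graded_almost_prime R (f -` J)"
proof -
  let ?P = "f -` J"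
  have hom: "ring_homomorphism f"
    using assms(3) by (simp add: graded_ring_homomorphism_def)
  have J: "graded_right_ideal T J" "J \<noteq> UNIV"
    and prime: "\<And>X Y. graded_right_ideal T X \<Longrightarrow> graded_right_ideal T Y \<Longrightarrow>
      ideal_prod X Y \<subseteq> J \<Longrightarrow> \<not> ideal_prod X Y \<subseteq> ideal_prod J J \<Longrightarrow> X \<subseteq> J \<or> Y \<subseteq> J"
    using assms(5) unfolding graded_almost_prime_def by blast+
  have fP: "f ` ?P = J"
    using \<open>surj f\<close> by (rule surj_image_vimage_eq)
  have "graded_right_ideal R ?P"
    by (rule graded_right_ideal_vimage[OF assms(1-3) J(1)])
  moreover have "?P \<noteq> UNIV"
    using J(2) fP \<open>surj f\<close> by metis
  moreover have "X \<subseteq> ?P \<or> Y \<subseteq> ?P"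
    if X: "graded_right_ideal R X" and Y: "graded_right_ideal R Y"
      and XY: "ideal_prod X Y \<subseteq> ?P" and not_sq: "\<not> ideal_prod X Y \<subseteq> ideal_prod ?P ?P" for X Y
  proof -
    have "ideal_prod (f ` X) (f ` Y) \<subseteq> J"
      using XY unfolding image_ideal_prod[OF hom, symmetric] by blast
    moreover have "\<not> ideal_prod (f ` X) (f ` Y) \<subseteq> ideal_prod J J"
    proof
      assume "ideal_prod (f ` X) (f ` Y) \<subseteq> ideal_prod J J"
      then have "f ` ideal_prod X Y \<subseteq> f ` ideal_prod ?P ?P"
        unfolding image_ideal_prod[OF hom] fP .
      then have "ideal_prod X Y \<subseteq> ideal_prod ?P ?P"
        using ideal_prod_saturated[OF hom assms(6)] by blast
      with not_sq show False ..
    qed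
    ultimately have "f ` X \<subseteq> J \<or> f ` Y \<subseteq> J"
      using prime graded_right_ideal_image[OF assms(1-4)] X Y by blast
    then show ?thesis
      by blast
  qed
  ultimately show ?thesis
    unfolding graded_almost_prime_def by blast
qed

end
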